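(* Let $p$ be an odd prime, $\alpha\in\mathbb Z_p^\times$ and $\beta,\gamma,\delta,\epsilon\in\mathbb Z_p$. Suppose that (i) $\langle-\alpha\rangle_p\leq\min\{\langle-\delta\rangle_p, \langle-\epsilon\rangle_p\}$, $\langle-\beta\rangle_p\leq \langle-\delta\rangle_p$ and $\langle-\gamma\rangle_p\leq \langle-\epsilon\rangle_p$; (ii) $\langle-\alpha\rangle_p+\langle-\beta\rangle_p+\langle-\gamma\rangle_p\geq p+\max\{\langle-\delta\rangle_p,\langle-\epsilon\rangle_p\}$; (iii) $(\delta)_{p-1}\not\equiv0\pmod{p^2}$ and $(\epsilon)_{p-1}\not\equiv0\pmod{p^2}$. Let $\rho=\delta+\epsilon-\alpha-\beta-\gamma$. Then $$ {}_4F_3\bigg[\begin{matrix}\rho&\alpha&\beta&\gamma\\&1&\delta&\epsilon\end{matrix}\bigg|\,1\bigg]_{p-1}\equiv0\pmod{p^2}. $$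
   Context: $\mathbb Z_p$ denotes the $p$-adic integers and $\mathbb Z_p^\times$ its units. For $\alpha\in\mathbb Z_p$, $\langle\alpha\rangle_p$ is the unique integer in $\{0,1,\ldots,p-1\}$ congruent to $\alpha$ modulo $p$. Pochhammer symbol: $(x)_0=1$, $(x)_k=x(x+1)\cdots(x+k-1)$. For $n\ge 0$, ${}_{4}F_3\Big[\begin{matrix}\alpha_0&\alpha_1&\alpha_2&\alpha_3\\&\beta_1&\beta_2&\beta_3\end{matrix}\Big|\,z\Big]_n=\sum_{k=0}^{n}\frac{(\alpha_0)_k(\alpha_1)_k(\alpha_2)_k(\alpha_3)_k}{(\beta_1)_k(\beta_2)_k(\beta_3)_k}\cdot\frac{z^k}{k!}$. For $x,y\in\mathbb Q_p$, $x\equiv y\pmod{p^2}$ means $x-y\in p^2\mathbb Z_p$. *)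

theory Defs
  imports
    "HOL-Computational_Algebra.Polynomial_Factorial"
    "Berlekamp_Zassenhaus.Finite_Field"
begin

section \<open>The ring of \<open>p\<close>-adic integers\<close>

text \<open>
  The prime \<open>p\<close> is the cardinality of the index type \<open>'p\<close> of class \<open>prime_card\<close>.
  A \<open>p\<close>-adic integer is an element of the inverse limit of the rings \<open>\<int>/p\<^sup>n\<close>: a sequence of
  residues, normalised to lie in \<open>{0..<p\<^sup>n}\<close>, each being the reduction of the next one.
  (The normalisation is implied by the coherence condition, see \<open>padic_coherent_range\<close>.)
\<close>

definition padic_coherent :: "nat \<Rightarrow> (nat \<Rightarrow> int) \<Rightarrow> bool" where
  "padic_coherent p x \<longleftrightarrow> (\<forall>n. x n = x (Suc n) mod int p ^ n)"

lemma padic_coherent_range: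
  assumes "padic_coherent p x" "p > 0"
  shows "x n \<in> {0..<int p ^ n}"
proof -
  have "x n = x (Suc n) mod int p ^ n"
    using assms unfolding padic_coherent_def by blast
  thus ?thesis using assms(2) by simp
qed

lemma padic_coherent_le:
  assumes "padic_coherent p x" "m \<le> n"
  shows "x n mod int p ^ m = x m"
  using assms(2)
proof (induction n rule: dec_induct)
  case base
  have "x m = x (Suc m) mod int p ^ m"
    using assms unfolding padic_coherent_def by blast
  thus ?case by simp
next
  case (step n)
  have "x (Suc n) mod int p ^ m = x (Suc n) mod int p ^ n mod int p ^ m"
    using step.hyps by (simp add: mod_mod_cancel le_imp_power_dvd)
  also have "x (Suc n) mod int p ^ n = x n"
    using assms(1) unfolding padic_coherent_def by metis
  finally show ?case using step.IH by simp
qed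

lemma padic_coherent_mod [simp]: "padic_coherent p x \<Longrightarrow> x n mod int p ^ n = x n"
  by (simp add: padic_coherent_le)

lemma padic_coherentI:
  assumes "\<And>n. f (Suc n) mod int p ^ n = f n mod int p ^ n"
  shows "padic_coherent p (\<lambda>n. f n mod int p ^ n)"
  unfolding padic_coherent_def by (simp add: assms mod_mod_cancel)

lemma padic_coherentD: "padic_coherent p x \<Longrightarrow> x (Suc n) mod int p ^ n = x n mod int p ^ n"
  unfolding padic_coherent_def by (metis mod_mod_trivial)

typedef 'p padic_int = "{x. padic_coherent CARD('p::prime_card) x}"
  morphisms padic_res Abs_padic_int
  by (rule exI[of _ "\<lambda>_. 0"]) (simp add: padic_coherent_def)

setup_lifting type_definition_padic_int

lemma CARD_prime_card_pos: "CARD('p::prime_card) > 0"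
  using prime_card[where 'a = 'p] by (rule prime_gt_0_nat)

instantiation padic_int :: (prime_card) comm_ring_1
begin

lift_definition zero_padic_int :: "'a padic_int" is "\<lambda>n. 0"
  by (simp add: padic_coherent_def)

lift_definition one_padic_int :: "'a padic_int" is "\<lambda>n. 1 mod int CARD('a) ^ n"
  by (rule padic_coherentI) simp

lift_definition plus_padic_int :: "'a padic_int \<Rightarrow> 'a padic_int \<Rightarrow> 'a padic_int"
  is "\<lambda>x y n. (x n + y n) mod int CARD('a) ^ n"
  by (rule padic_coherentI) (rule mod_add_cong; erule padic_coherentD)

lift_definition minus_padic_int :: "'a padic_int \<Rightarrow> 'a padic_int \<Rightarrow> 'a padic_int"
  is "\<lambda>x y n. (x n - y n) mod int CARD('a) ^ n"
  by (rule padic_coherentI) (rule mod_diff_cong; erule padic_coherentD)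

lift_definition uminus_padic_int :: "'a padic_int \<Rightarrow> 'a padic_int"
  is "\<lambda>x n. (- x n) mod int CARD('a) ^ n"
  by (rule padic_coherentI) (rule mod_minus_cong, erule padic_coherentD)

lift_definition times_padic_int :: "'a padic_int \<Rightarrow> 'a padic_int \<Rightarrow> 'a padic_int"
  is "\<lambda>x y n. (x n * y n) mod int CARD('a) ^ n"
  by (rule padic_coherentI) (rule mod_mult_cong; erule padic_coherentD)

instance
proof
  fix a b c :: "'a padic_int"
  show "a * b * c = a * (b * c)"
    by transfer (simp add: fun_eq_iff mod_mult_left_eq mod_mult_right_eq mult.assoc)
  show "a * b = b * a"
    by transfer (simp add: fun_eq_iff mult.commute)
  show "1 * a = a"
    by transfer (simp add: fun_eq_iff mod_mult_left_eq)
  show "a + b + c = a + (b + c)"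
    by transfer (simp add: fun_eq_iff mod_add_left_eq mod_add_right_eq add.assoc)
  show "a + b = b + a"
    by transfer (simp add: fun_eq_iff add.commute)
  show "0 + a = a"
    by transfer (simp add: fun_eq_iff)
  show "- a + a = 0"
    by transfer (simp add: fun_eq_iff mod_add_left_eq)
  show "a - b = a + - b"
    by transfer (simp add: fun_eq_iff mod_add_right_eq)
  show "(a + b) * c = a * c + b * c"
    by transfer (simp add: fun_eq_iff mod_mult_left_eq mod_add_eq distrib_right)
  show "(0 :: 'a padic_int) \<noteq> 1"
  proof transfer
    have "int CARD('a) > 1"
      using prime_card[where 'a = 'a] prime_gt_1_nat by simp
    hence "1 mod int CARD('a) ^ 1 \<noteq> 0" by simp
    thus "(\<lambda>n. 0) \<noteq> (\<lambda>n. 1 mod int CARD('a) ^ n)" by metis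
  qed
qed

end

lemma padic_coherent_padic_res: "padic_coherent CARD('p) (padic_res (x :: 'p::prime_card padic_int))"
  using padic_res[of x] by simp

lemma padic_res_of_nat: "padic_res (of_nat m :: 'p::prime_card padic_int) n = int m mod int CARD('p) ^ n"
  by (induction m)
    (auto simp: zero_padic_int.rep_eq one_padic_int.rep_eq plus_padic_int.rep_eq mod_add_eq)

instance padic_int :: (prime_card) idom
proof
  fix a b :: "'a padic_int"
  assume "a \<noteq> 0" "b \<noteq> 0"
  let ?p = "int CARD('a)"
  note coh = padic_coherent_padic_res
  obtain m where m: "padic_res a m \<noteq> 0"
    using \<open>a \<noteq> 0\<close> by (auto simp: zero_padic_int.rep_eq fun_eq_iff simp flip: padic_res_inject)
  obtain n where n: "padic_res b n \<noteq> 0"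
    using \<open>b \<noteq> 0\<close> by (auto simp: zero_padic_int.rep_eq fun_eq_iff simp flip: padic_res_inject)
  let ?x = "padic_res a (m + n)" and ?y = "padic_res b (m + n)"
  have x: "\<not> ?p ^ m dvd ?x"
    using padic_coherent_le[OF coh, of m "m + n" a] m by (auto simp: dvd_eq_mod_eq_0)
  have y: "\<not> ?p ^ n dvd ?y"
    using padic_coherent_le[OF coh, of n "m + n" b] n by (auto simp: dvd_eq_mod_eq_0)
  have pp: "prime ?p"
    by (rule prime_card_int)
  have x0: "?x \<noteq> 0" and y0: "?y \<noteq> 0" using x y by (metis dvd_0_right)+
  have "\<not> ?p ^ (m + n) dvd ?x * ?y"
  proof
    assume dvd: "?p ^ (m + n) dvd ?x * ?y"
    have "multiplicity ?p ?x < m" "multiplicity ?p ?y < n"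
      using x y by (auto intro!: multiplicity_lessI simp: x0 y0 pp not_prime_unit)
    moreover have "m + n \<le> multiplicity ?p (?x * ?y)"
      using dvd x0 y0 pp by (intro multiplicity_geI) (auto simp: not_prime_unit)
    moreover have "multiplicity ?p (?x * ?y) = multiplicity ?p ?x + multiplicity ?p ?y"
      using pp x0 y0 by (intro prime_elem_multiplicity_mult_distrib) auto
    ultimately show False by simp
  qed
  hence "padic_res (a * b) (m + n) \<noteq> 0"
    by (simp add: times_padic_int.rep_eq dvd_eq_mod_eq_0)
  thus "a * b \<noteq> 0" by (auto simp: zero_padic_int.rep_eq)
qed

instance padic_int :: (prime_card) ring_char_0
proof
  show "inj (of_nat :: nat \<Rightarrow> 'a padic_int)"
  proof (rule injI)
    fix i j :: nat
    assume eq: "(of_nat i :: 'a padic_int) = of_nat j"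
    have "CARD('a) > 1"
      using prime_card[where 'a = 'a] by (rule prime_gt_1_nat)
    have "i + j < CARD('a) ^ (i + j)"
      using \<open>CARD('a) > 1\<close> by (simp add: power_gt_expt)
    hence "int i < int CARD('a) ^ (i + j)" "int j < int CARD('a) ^ (i + j)"
      by (simp_all flip: of_nat_power)
    hence "int i mod int CARD('a) ^ (i + j) = int i" "int j mod int CARD('a) ^ (i + j) = int j"
      by simp_all
    moreover have "int i mod int CARD('a) ^ (i + j) = int j mod int CARD('a) ^ (i + j)"
      using eq by (metis padic_res_of_nat)
    ultimately show "i = j" by simp
  qed
qed

instance fract :: ("{idom, ring_char_0}") field_char_0
proof
  show "inj (of_nat :: nat \<Rightarrow> 'a fract)"
    by (rule injI) (simp add: of_nat_fract eq_fract)
qed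


section \<open>The least nonnegative residue modulo \<open>p\<close>\<close>

definition padic_residue :: "'p::prime_card padic_int \<Rightarrow> nat" where
  "padic_residue x = (THE r. r < CARD('p) \<and> of_nat CARD('p) dvd x - of_nat r)"

lemma p_dvd_padic_int_iff:
  fixes x :: "'p::prime_card padic_int"
  shows "of_nat CARD('p) dvd x \<longleftrightarrow> padic_res x 1 = 0"
proof
  assume "of_nat CARD('p) dvd x"
  then obtain y where "x = of_nat CARD('p) * y" by (auto elim: dvdE)
  thus "padic_res x 1 = 0"
    by (simp add: times_padic_int.rep_eq padic_res_of_nat)
next
  let ?p = "int CARD('p)"
  define y where "y n = padic_res x (Suc n) div ?p" for n
  note coh = padic_coherent_padic_res[of x]
  assume x1: "padic_res x 1 = 0"
  have "padic_coherent CARD('p) y"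
    unfolding padic_coherent_def
  proof
    fix n
    have "padic_res x (Suc n) = padic_res x (Suc (Suc n)) mod (?p * ?p ^ n)"
      using padic_coherent_le[OF coh, of "Suc n" "Suc (Suc n)"] by simp
    also have "\<dots> = ?p * (padic_res x (Suc (Suc n)) div ?p mod ?p ^ n)
        + padic_res x (Suc (Suc n)) mod ?p"
      by (rule zmod_zmult2_eq) simp
    also have "padic_res x (Suc (Suc n)) mod ?p = 0"
      using padic_coherent_le[OF coh, of 1 "Suc (Suc n)"] x1 by simp
    finally show "y n = y (Suc n) mod ?p ^ n"
      using CARD_prime_card_pos[where 'p = 'p] by (simp add: y_def)
  qed
  hence rep: "padic_res (Abs_padic_int y :: 'p padic_int) = y"
    by (simp add: Abs_padic_int_inverse)
  have "x = of_nat CARD('p) * Abs_padic_int y"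
  proof (rule iffD1[OF padic_res_inject], rule ext)
    fix n
    have dvd: "?p dvd padic_res x (Suc n)"
      using padic_coherent_le[OF coh, of 1 "Suc n"] x1 by (simp add: dvd_eq_mod_eq_0)
    have "padic_res (of_nat CARD('p) * Abs_padic_int y :: 'p padic_int) n
        = (?p * y n) mod ?p ^ n"
      by (simp add: times_padic_int.rep_eq padic_res_of_nat rep mod_mult_left_eq)
    also have "?p * y n = padic_res x (Suc n)"
      using dvd by (simp add: y_def)
    also have "\<dots> mod ?p ^ n = padic_res x n"
      using padic_coherent_le[OF coh, of n "Suc n"] by simp
    finally show "padic_res x n = padic_res (of_nat CARD('p) * Abs_padic_int y :: 'p padic_int) n"
      by simp
  qed
  thus "of_nat CARD('p) dvd x" by simp
qed

lemma p_dvd_diff_of_nat_iff: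
  fixes x :: "'p::prime_card padic_int"
  assumes "r < CARD('p)"
  shows "of_nat CARD('p) dvd x - of_nat r \<longleftrightarrow> r = nat (padic_res x 1)"
proof -
  let ?p = "int CARD('p)"
  have "padic_res x 1 \<in> {0..<?p}"
    using padic_coherent_range[OF padic_coherent_padic_res[of x] CARD_prime_card_pos, of 1] by simp
  hence range: "0 \<le> padic_res x 1" "padic_res x 1 < ?p" by auto
  have "of_nat CARD('p) dvd x - of_nat r \<longleftrightarrow> ?p dvd padic_res x 1 - int r"
    using assms by (simp add: p_dvd_padic_int_iff minus_padic_int.rep_eq padic_res_of_nat dvd_eq_mod_eq_0)
  also have "\<dots> \<longleftrightarrow> padic_res x 1 mod ?p = int r mod ?p"
    by (simp add: mod_eq_dvd_iff)
  also have "\<dots> \<longleftrightarrow> r = nat (padic_res x 1)"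
    using range assms by auto
  finally show ?thesis .
qed

lemma padic_residue_ex1:
  fixes x :: "'p::prime_card padic_int"
  shows "\<exists>!r. r < CARD('p) \<and> of_nat CARD('p) dvd x - of_nat r"
proof -
  have "nat (padic_res x 1) < CARD('p)"
    using padic_coherent_range[OF padic_coherent_padic_res[of x] CARD_prime_card_pos, of 1] by auto
  thus ?thesis using p_dvd_diff_of_nat_iff[of _ x] by metis
qed


section \<open>The field of \<open>p\<close>-adic numbers\<close>

type_synonym 'p padic = "'p padic_int fract"

text \<open>Congruence in \<open>\<rat>\<^sub>p\<close> modulo the additive subgroup \<open>p\<^sup>m\<int>\<^sub>p\<close>.\<close>

definition padic_cong :: "nat \<Rightarrow> 'p::prime_card padic \<Rightarrow> 'p padic \<Rightarrow> bool" where
  "padic_cong m x y \<longleftrightarrow> (\<exists>z. x - y = of_nat CARD('p) ^ m * to_fract z)"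


section \<open>Truncated hypergeometric series\<close>

definition trunc_hypergeo :: "'a::field_char_0 list \<Rightarrow> 'a list \<Rightarrow> 'a \<Rightarrow> nat \<Rightarrow> 'a" where
  "trunc_hypergeo as bs z n =
     (\<Sum>k=0..n. (\<Prod>a\<leftarrow>as. pochhammer a k) / (\<Prod>b\<leftarrow>bs. pochhammer b k) * (z ^ k / fact k))"

end

theory Submission
  imports Defs
begin

text \<open>
  Write \<open>a, b, c, d, e\<close> for the least residues of \<open>-\<alpha>, -\<beta>, -\<gamma>, -\<delta>, -\<epsilon>\<close>, let
  \<open>n = p + d + e - a - b - c\<close>, so that \<open>\<rho> \<equiv> -n (mod p)\<close>, and let \<open>m = min d e\<close>. The terms
  with \<open>k > m\<close> vanish modulo \<open>p\<^sup>2\<close>, and for \<open>k \<le> m\<close> all denominators are units.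

  If \<open>\<rho> = -n\<close> or \<open>\<alpha> = -a\<close> exactly, the remaining sum is a terminating balanced series, and
  Whipple's transformation turns it into a sum each of whose terms has two factors \<open>p\<close>.
  In general put \<open>P = \<rho> + n\<close> and \<open>Q = \<alpha> + a\<close>. Both are divisible by \<open>p\<close>, so modulo \<open>p\<^sup>2\<close> the
  sum \<open>F(\<rho>, \<alpha>, \<beta>)\<close> is affine in such perturbations of its arguments, and hence
  \<open>F(-n + P, -a + Q, \<beta>) \<equiv> F(-n + P, -a, \<beta> + Q) + F(-n, -a + Q, \<beta> + P) - F(-n, -a, \<beta> + P + Q)\<close>.
  The three series on the right are still balanced, and they terminate.
\<close>

section \<open>Summation and transformation formulas\<close>

text \<open>This is the terminating balanced \<open>3F2\<close> sum multiplied by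
  \<open>(C)\<^sub>k (C - A - B)\<^sub>k\<close>, which leaves a polynomial identity without
  division. The proof is creative telescoping in \<open>k\<close>.\<close>

lemma pfaff_saalschuetz:
  fixes A B C :: "'a::comm_ring_1"
  shows "(\<Sum>j\<le>k. of_nat (k choose j) * pochhammer A j * pochhammer B j *
            pochhammer (C + of_nat j) (k - j) * pochhammer (C - A - B) (k - j)) =
         pochhammer (C - A) k * pochhammer (C - B) k"
proof (induction k)
  case 0
  then show ?case by simp
next
  case (Suc k)
  define s where "s = C - A - B"
  define t where "t k j = of_nat (k choose j) * pochhammer A j * pochhammer B j *
      pochhammer (C + of_nat j) (k - j) * pochhammer s (k - j)" for k j
  \<comment> \<open>the WZ certificate for the recurrence in \<open>k\<close> (Zeilberger's algorithm)\<close>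
  define g where "g j = (case j of 0 \<Rightarrow> 0 | Suc i \<Rightarrow> - (of_nat (k choose i) *
      pochhammer A (Suc i) * pochhammer B (Suc i) *
      pochhammer (C + of_nat i) (k - i) * pochhammer s (k - i)))" for j
  have C: "C = s + A + B" by (simp add: s_def)
  have step: "t (Suc k) j = (C - A + of_nat k) * (C - B + of_nat k) * t k j + (g (Suc j) - g j)"
    if jk: "j \<le> k" for j
  proof (cases j)
    case 0
    have "t (Suc k) 0 - ((C - A + of_nat k) * (C - B + of_nat k) * t k 0 + g (Suc 0)) = 
      pochhammer C k * pochhammer s k * 
        ((C + of_nat k) * (s + of_nat k) - (C - A + of_nat k) * (C - B + of_nat k) + A * B)"
      by (simp add: t_def g_def pochhammer_Suc[of C] pochhammer_Suc[of s] algebra_simps)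
    also have "(C + of_nat k) * (s + of_nat k) - (C - A + of_nat k) * (C - B + of_nat k) + A * B = 0"
      by (simp add: s_def algebra_simps)
    finally show ?thesis using 0 by (simp add: g_def)
  next
    case (Suc i)
    obtain l where l: "k = j + l" using le_Suc_ex[OF jk] by blast
    \<comment> \<open>Besides Pascal's rule, this relation between neighbouring binomials is all
      that is needed: the defect of the recurrence turns out to be a multiple of it.\<close>
    have "Suc i * (k choose Suc i) = (k - i) * (k choose i)"
      by (rule trans[OF binomial_absorption binomial_absorb_comp[symmetric]])
    then have ch: "of_nat (Suc i) * of_nat (k choose Suc i)
                 = of_nat (Suc l) * (of_nat (k choose i) :: 'a)"
      unfolding of_nat_mult[symmetric] using l Suc by simp
    define a b where "a = (of_nat (k choose i) :: 'a)" and "b = (of_nat (k choose Suc i) :: 'a)"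
    define P Q U V where "P = pochhammer A j" and "Q = pochhammer B j"
      and "U = pochhammer (C + of_nat j) l" and "V = pochhammer s l"
    define I L where "I = (of_nat i :: 'a)" and "L = (of_nat l :: 'a)"
    have ch': "(1 + I) * b = (1 + L) * a" using ch by (simp add: a_def b_def I_def L_def)
    have t1: "t (Suc k) j = (a + b) * P * Q * (U * (C + (1 + I) + L)) * (V * (s + L))"
      unfolding t_def P_def Q_def U_def V_def a_def b_def I_def L_def using l Suc
      by (simp add: pochhammer_Suc)
    have t0: "t k j = b * P * Q * U * V"
      unfolding t_def P_def Q_def U_def V_def a_def b_def using l Suc by simp
    have g1: "g (Suc j) = - (b * (P * (A + (1 + I))) * (Q * (B + (1 + I))) * U * V)"
      unfolding g_def P_def Q_def U_def V_def a_def b_def I_def using l Suc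
      by (simp add: pochhammer_Suc)
    have g0: "g j = - (a * P * Q * ((C + I) * U) * (V * (s + L)))"
    proof -
      have "pochhammer (C + of_nat i) (Suc l) = (C + I) * U"
        by (simp only: pochhammer_rec) (simp add: U_def I_def Suc add_ac)
      moreover have "k - i = Suc l" using l Suc by simp
      ultimately show ?thesis
        unfolding g_def P_def Q_def V_def a_def L_def using Suc by (simp add: pochhammer_Suc)
    qed
    have k: "of_nat k = 1 + I + L" using l Suc by (simp add: I_def L_def)
    have "t (Suc k) j - ((C - A + of_nat k) * (C - B + of_nat k) * t k j + (g (Suc j) - g j))
      = P * Q * U * V * (s + L) * ((1 + L) * a - (1 + I) * b)"
      unfolding t1 t0 g1 g0 k C by (simp add: algebra_simps)
    then show ?thesis using ch' by simp
  qed
  have "(\<Sum>j\<le>Suc k. t (Suc k) j) =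
      (\<Sum>j<Suc k. (C - A + of_nat k) * (C - B + of_nat k) * t k j + (g (Suc j) - g j)) + t (Suc k) (Suc k)"
    unfolding lessThan_Suc_atMost sum.atMost_Suc using step by simp
  also have "\<dots> = (C - A + of_nat k) * (C - B + of_nat k) * (\<Sum>j\<le>k. t k j)
      + (g (Suc k) - g 0) + t (Suc k) (Suc k)"
    by (simp add: sum.distrib sum_distrib_left lessThan_Suc_atMost del: sum.lessThan_Suc)
      (simp add: sum_lessThan_telescope flip: lessThan_Suc_atMost del: sum.lessThan_Suc)
  \<comment> \<open>The boundary term \<open>g (Suc k)\<close> cancels the top summand
    \<open>t (Suc k) (Suc k)\<close>, which \<open>step\<close> does not cover.\<close>
  also have "\<dots> = (C - A + of_nat k) * (C - B + of_nat k) * (\<Sum>j\<le>k. t k j)"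
    by (simp add: g_def t_def)
  also have "(\<Sum>j\<le>k. t k j) = pochhammer (C - A) k * pochhammer (C - B) k"
    using Suc.IH by (simp add: t_def s_def)
  finally show ?case
    by (simp add: t_def s_def pochhammer_Suc mult_ac)
qed

text \<open>
  Whipple's transformation of balanced terminating \<open>\<^sub>4F\<^sub>3\<close> series, multiplied by
  \<open>(\<eta>)\<^sub>n (\<delta>)\<^sub>n (\<epsilon>)\<^sub>n\<close> so that it becomes a polynomial identity. One application of
  Pfaff--Saalschuetz expands \<open>(y)\<^sub>k (z)\<^sub>k\<close>; after exchanging the sums, a second one
  evaluates the inner sum.
\<close>

lemma whipple_terminating:
  fixes x y z \<eta> \<delta> \<epsilon> :: "'a::comm_ring_1"
  assumes "\<eta> + \<delta> + \<epsilon> = 1 - of_nat n + x + y + z"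
  shows "(\<Sum>k\<le>n. (- 1) ^ k * of_nat (n choose k) * pochhammer x k * pochhammer y k * pochhammer z k *
            pochhammer (\<eta> + of_nat k) (n - k) * pochhammer (\<delta> + of_nat k) (n - k) *
            pochhammer (\<epsilon> + of_nat k) (n - k)) =
         (\<Sum>k\<le>n. (- 1) ^ k * of_nat (n choose k) * pochhammer x k * pochhammer (\<eta> - y) k *
            pochhammer (\<eta> - z) k * pochhammer (\<eta> + of_nat k) (n - k) *
            pochhammer (\<delta> - x) (n - k) * pochhammer (\<epsilon> - x) (n - k))"
  (is "(\<Sum>k\<le>n. ?L k) = (\<Sum>k\<le>n. ?R k)")
proof -
  \<comment> \<open>\<open>w\<close> is \<open>C - A - B\<close> for \<open>A = \<eta> - y\<close>,
    \<open>B = \<eta> - z\<close>, \<open>C = \<eta>\<close>, the choice for which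
    \<open>C - A = y\<close> and \<open>C - B = z\<close>.\<close>
  define w where "w = y + z - \<eta>"
  define f where "f k j = (- 1) ^ k * of_nat (n choose k) * of_nat (k choose j) * pochhammer x k *
      pochhammer (\<eta> - y) j * pochhammer (\<eta> - z) j * pochhammer w (k - j) *
      pochhammer (\<eta> + of_nat j) (n - j) *
      pochhammer (\<delta> + of_nat k) (n - k) * pochhammer (\<epsilon> + of_nat k) (n - k)" for k j
  have left: "?L k = (\<Sum>j\<le>k. f k j)" if "k \<le> n" for k
  proof -
    have yz: "pochhammer y k * pochhammer z k = (\<Sum>j\<le>k. of_nat (k choose j) * pochhammer (\<eta> - y) j *
        pochhammer (\<eta> - z) j * pochhammer (\<eta> + of_nat j) (k - j) * pochhammer w (k - j))"
      using pfaff_saalschuetz[of k "\<eta> - y" "\<eta> - z" \<eta>] by (simp add: w_def algebra_simps)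
    have split: "pochhammer (\<eta> + of_nat j) (n - j) =
        pochhammer (\<eta> + of_nat j) (k - j) * pochhammer (\<eta> + of_nat k) (n - k)" if "j \<le> k" for j
      using pochhammer_product[of "k - j" "n - j" "\<eta> + of_nat j"] that \<open>k \<le> n\<close>
      by (simp add: of_nat_diff)
    define c where "c = (- 1) ^ k * of_nat (n choose k) * pochhammer x k *
      pochhammer (\<eta> + of_nat k) (n - k) * pochhammer (\<delta> + of_nat k) (n - k) *
      pochhammer (\<epsilon> + of_nat k) (n - k)"
    have "f k j = c * (of_nat (k choose j) * pochhammer (\<eta> - y) j *
        pochhammer (\<eta> - z) j * pochhammer (\<eta> + of_nat j) (k - j) * pochhammer w (k - j))" if "j \<le> k" for j
      unfolding f_def c_def split[OF that] by (simp only: mult_ac)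
    then have "(\<Sum>j\<le>k. f k j) = c * (pochhammer y k * pochhammer z k)"
      unfolding yz sum_distrib_left by (intro sum.cong refl) simp
    then show ?thesis unfolding c_def by (simp only: mult_ac)
  qed
  have right: "(\<Sum>i\<le>n - j. f (j + i) j) = ?R j" if "j \<le> n" for j
  proof -
    define N where "N = n - j"
    define X D E where "X = x + of_nat j" and "D = \<delta> + of_nat j" and "E = \<epsilon> + of_nat j"
    define c where "c = (- 1) ^ j * of_nat (n choose j) * pochhammer x j *
      pochhammer (\<eta> - y) j * pochhammer (\<eta> - z) j * pochhammer (\<eta> + of_nat j) (n - j)"
    have n: "of_nat n = of_nat N + (of_nat j :: 'a)" using that by (simp add: N_def of_nat_diff)
    \<comment> \<open>Here the balancing condition enters. In the second summation
      \<open>A = X\<close>, \<open>B = w\<close>, \<open>C = D\<close>, it makes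
      \<open>C - A - B\<close> equal to \<open>1 - N - E\<close>, whose Pochhammer symbol is that of
      \<open>E + i\<close> read backwards, up to sign.\<close>
    have w: "w = D - (1 - of_nat N - E + X)"
      using assms n unfolding w_def X_def D_def E_def by (simp add: algebra_simps)
    have rev: "pochhammer (1 - of_nat N - E) (N - i) = (- 1) ^ (N - i) * pochhammer (E + of_nat i) (N - i)"
      if "i \<le> N" for i
      using that pochhammer_minus[of "E + of_nat N - 1" "N - i"] by (simp add: of_nat_diff algebra_simps)
    have rev': "pochhammer (1 - of_nat N - E + X) N = (- 1) ^ N * pochhammer (E - X) N"
      using pochhammer_minus[of "E + of_nat N - 1 - X" "N"] by (simp add: algebra_simps)
    have "f (j + i) j = c * (-1) ^ N * (of_nat (N choose i) * pochhammer X i * pochhammer w i *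
            pochhammer (D + of_nat i) (N - i) * pochhammer (D - X - w) (N - i))" if i: "i \<le> N" for i
    proof -
      have "(n choose (j + i)) * ((j + i) choose j) = (n choose j) * (N choose i)"
        using choose_mult[of j "j + i" n] i \<open>j \<le> n\<close> by (simp add: N_def)
      then have ch: "of_nat (n choose (j + i)) * of_nat ((j + i) choose j) =
          (of_nat (n choose j) * of_nat (N choose i) :: 'a)"
        unfolding of_nat_mult[symmetric] by simp
      have Dw: "D - X - w = 1 - of_nat N - E" using w by simp
      have sgn: "(-1) ^ N * (-1) ^ (N - i) = ((-1) ^ i :: 'a)"
      proof -
        obtain m where "N = i + m" using le_Suc_ex[OF i] by blast
        then show ?thesis by (simp add: power_add mult.assoc)
      qed
      have "f (j + i) j =
          (- 1) ^ (j + i) * (of_nat (n choose (j + i)) * of_nat ((j + i) choose j)) *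
          pochhammer x (j + i) * pochhammer (\<eta> - y) j * pochhammer (\<eta> - z) j *
          pochhammer w i * pochhammer (\<eta> + of_nat j) (n - j) *
          pochhammer (D + of_nat i) (N - i) * pochhammer (E + of_nat i) (N - i)"
        by (simp add: f_def D_def E_def N_def add_ac)
      also have "\<dots> = c * ((-1) ^ N * (-1) ^ (N - i)) * of_nat (N choose i) * pochhammer X i * pochhammer w i *
            pochhammer (D + of_nat i) (N - i) * pochhammer (E + of_nat i) (N - i)"
        unfolding ch sgn by (simp add: c_def X_def power_add pochhammer_product' mult_ac)
      finally show ?thesis unfolding Dw using rev[OF i] by (simp add: mult_ac)
    qed
    then have "(\<Sum>i\<le>N. f (j + i) j) = c * (-1) ^ N * (pochhammer (D - X) N * pochhammer (D - w) N)"
      by (simp add: pfaff_saalschuetz[symmetric] sum_distrib_left)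
    also have "D - w = 1 - of_nat N - E + X" using w by simp
    also note rev'
    finally show ?thesis
      by (simp add: N_def c_def D_def E_def X_def mult_ac)
  qed
  have "(\<Sum>k\<le>n. ?L k) = (\<Sum>k\<le>n. \<Sum>j\<le>k. f k j)" using left by simp
  also have "\<dots> = (\<Sum>j\<le>n. \<Sum>i\<le>n - j. f (j + i) j)"
  proof -
    have "(\<Sum>k\<le>n. \<Sum>j\<le>k. f k j) = (\<Sum>k\<le>n. \<Sum>j\<le>k. f (j + (k - j)) j)" by simp
    also have "\<dots> = (\<Sum>(j, i) \<in> {(j, i). j + i \<le> n}. f (j + i) j)"
      by (rule sum.triangle_reindex_eq[symmetric])
    also have "{(j, i). j + i \<le> n} = (SIGMA j:{..n}. {..n - j})" by auto
    finally show ?thesis by (simp add: sum.Sigma)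
  qed
  also have "\<dots> = (\<Sum>k\<le>n. ?R k)" using right by simp
  finally show ?thesis .
qed

section \<open>Divisibility by the square of a prime\<close>

text \<open>\<open>D\<close> is the derivative at \<open>x\<close>, built by the product rule. It
  must not depend on \<open>h\<close>, since expansions with different increments are compared
  later.\<close>

lemma pochhammer_add:
  fixes x :: "'a::comm_ring_1"
  shows "\<exists>D. \<forall>h. h\<^sup>2 dvd pochhammer (x + h) k - (pochhammer x k + h * D)"
proof (induction k)
  case 0
  show ?case by (auto intro!: exI[of _ 0])
next
  case (Suc k)
  then obtain D where D: "h\<^sup>2 dvd pochhammer (x + h) k - (pochhammer x k + h * D)" for h by blast
  show ?case
  proof (intro exI[of _ "D * (x + of_nat k) + pochhammer x k"] allI)
    fix h
    have "pochhammer (x + h) (Suc k) -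
        (pochhammer x (Suc k) + h * (D * (x + of_nat k) + pochhammer x k)) =
      (pochhammer (x + h) k - (pochhammer x k + h * D)) * (x + h + of_nat k) + h\<^sup>2 * D"
      by (simp add: pochhammer_Suc power2_eq_square algebra_simps)
    then show "h\<^sup>2 dvd pochhammer (x + h) (Suc k) -
        (pochhammer x (Suc k) + h * (D * (x + of_nat k) + pochhammer x k))"
      using D[of h] by simp
  qed
qed

lemma prod3_first_order:
  fixes q :: "'a::comm_ring_1"
  assumes "q\<^sup>2 dvd x - (x0 + q * x1)" "q\<^sup>2 dvd y - (y0 + q * y1)" "q\<^sup>2 dvd z - (z0 + q * z1)"
  shows "q\<^sup>2 dvd x * y * z - (x0 * y0 * z0 + q * (x1 * y0 * z0 + x0 * y1 * z0 + x0 * y0 * z1))"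
proof -
  define x' y' z' where "x' = x0 + q * x1" and "y' = y0 + q * y1" and "z' = z0 + q * z1"
  have "x * y * z - (x0 * y0 * z0 + q * (x1 * y0 * z0 + x0 * y1 * z0 + x0 * y0 * z1)) =
      (x - x') * (y * z) + (y - y') * (x' * z) + (z - z') * (x' * y')
      + q\<^sup>2 * (x1 * y1 * z0 + x1 * y0 * z1 + x0 * y1 * z1 + q * x1 * y1 * z1)"
    by (simp add: x'_def y'_def z'_def power2_eq_square algebra_simps)
  also have "q\<^sup>2 dvd \<dots>"
    using assms by (intro dvd_add dvd_mult2) (auto simp: x'_def y'_def z'_def)
  finally show ?thesis .
qed

text \<open>The increments of \<open>(a, b, c)\<close> are \<open>(P, Q, 0)\<close>,
  \<open>(P, 0, Q)\<close>, \<open>(0, Q, P)\<close> and \<open>(0, 0, P + Q)\<close>. With signs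
  \<open>+ - - +\<close> the constant and the linear parts cancel, and all four have the same total,
  which preserves balancedness.\<close>

lemma pochhammer_prod_affine:
  fixes q :: "'a::comm_ring_1"
  assumes "q dvd P" "q dvd Q"
  shows "q\<^sup>2 dvd pochhammer (a + P) k * pochhammer (b + Q) k * pochhammer c k
            - pochhammer (a + P) k * pochhammer b k * pochhammer (c + Q) k
            - pochhammer a k * pochhammer (b + Q) k * pochhammer (c + P) k
            + pochhammer a k * pochhammer b k * pochhammer (c + (P + Q)) k"
proof -
  define f where "f = (\<lambda>x. pochhammer x k :: 'a)"
  have "\<exists>D. \<forall>h. q\<^sup>2 dvd f (x + q * h) - (f x + q * (h * D))" for x
    using pochhammer_add[of x k] unfolding f_def
    by (metis (no_types, opaque_lifting) dvd_mult_left mult.assoc power_mult_distrib)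
  then obtain D where D: "q\<^sup>2 dvd f (x + q * h) - (f x + q * (h * D x))" for x h by metis
  define g where "g r s t = f (a + q * r) * f (b + q * s) * f (c + q * t)
      - (f a * f b * f c + q * (r * D a * f b * f c + f a * (s * D b) * f c + f a * f b * (t * D c)))"
    for r s t
  have g: "q\<^sup>2 dvd g r s t" for r s t
    unfolding g_def by (rule prod3_first_order) (rule D)+
  obtain r s where rs: "P = q * r" "Q = q * s" using assms by (auto elim!: dvdE)
  have "f (a + P) * f (b + Q) * f c - f (a + P) * f b * f (c + Q)
      - f a * f (b + Q) * f (c + P) + f a * f b * f (c + (P + Q)) =
      g r s 0 - g r 0 s - g 0 s r + g 0 0 (r + s)"
    unfolding g_def rs by (simp add: algebra_simps)
  also have "q\<^sup>2 dvd \<dots>" by (intro dvd_add dvd_diff g)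
  finally show ?thesis unfolding f_def .
qed

section \<open>Terminating balanced series modulo \<open>p\<^sup>2\<close>\<close>

lemma dvd_pochhammer:
  fixes x :: "'a::comm_semiring_1"
  assumes "q dvd x + of_nat j" "j < k"
  shows "q dvd pochhammer x k"
  using assms unfolding pochhammer_prod 
  by (meson atLeastLessThan_iff dvd_prodI dvd_trans finite_atLeastLessThan le0)

text \<open>Whipple's transformation with \<open>\<eta> = 1\<close> produces
  \<open>(1 - y)\<^sub>k (\<delta> - x)\<^sub>n\<^sub>-\<^sub>k\<close> and
  \<open>(1 - z)\<^sub>k (\<epsilon> - x)\<^sub>n\<^sub>-\<^sub>k\<close> in each term, and
  \<open>p\<close> divides both products.\<close>

lemma whipple_sum_dvd:
  fixes x y z \<delta> \<epsilon> :: "'a::comm_ring_1"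
  assumes bal: "\<delta> + \<epsilon> = x - of_nat n + y + z"
    and res: "of_nat p dvd y + of_nat b" "of_nat p dvd z + of_nat c"
      "of_nat p dvd \<delta> + of_nat d" "of_nat p dvd \<epsilon> + of_nat e"
    and "b \<le> d" "c \<le> e" "d < p" "e < p" "p + max d e \<le> n + b + c"
  shows "(of_nat p)\<^sup>2 dvd (\<Sum>k\<le>n. (- 1) ^ k * of_nat (n choose k) * pochhammer x k *
            pochhammer y k * pochhammer z k * pochhammer (1 + of_nat k) (n - k) *
            pochhammer (\<delta> + of_nat k) (n - k) * pochhammer (\<epsilon> + of_nat k) (n - k))"
proof -
  have key: "of_nat p dvd pochhammer (1 - y') k * pochhammer (\<delta>' - x) (n - k)"
    if "\<delta>' + \<epsilon>' = x - of_nat n + y' + z'" "of_nat p dvd y' + of_nat b'" "of_nat p dvd z' + of_nat c'"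
      "of_nat p dvd \<epsilon>' + of_nat e'" "b' < p" "c' \<le> e'" "p + e' \<le> n + b' + c'"
    for y' z' \<delta>' \<epsilon>' :: 'a and b' c' e' k
  \<comment> \<open>From \<open>k = p - b'\<close> on, \<open>(1 - y')\<^sub>k\<close> contains the
    factor of index \<open>p - b' - 1\<close>, a multiple of \<open>p\<close>.\<close>
  proof (cases "p - b' \<le> k")
    case True
    have "1 - y' + of_nat (p - b' - 1) = of_nat p - (y' + of_nat b')"
      using that by (simp add: of_nat_diff)
    also have "of_nat p dvd \<dots>" using that by simp
    finally show ?thesis
      using True that by (intro dvd_mult2 dvd_pochhammer[of _ _ "p - b' - 1"]) auto
  next
    case False
    \<comment> \<open>For smaller \<open>k\<close> the multiple of \<open>p\<close> is the factor of
      index \<open>n - J\<close> in the other symbol. It occurs there because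
      \<open>c' \<le> e'\<close> gives \<open>k < p - b' \<le> J\<close>.\<close>
    define J where "J = p + e' - b' - c'"
    have J: "J + b' + c' = p + e'" "J \<le> n" "k < J"
      using that False by (auto simp: J_def)
    have "of_nat J + of_nat b' + of_nat c' = (of_nat p + of_nat e' :: 'a)"
      unfolding of_nat_add[symmetric] using J by simp
    then have J': "of_nat J = (of_nat p + of_nat e' - of_nat b' - of_nat c' :: 'a)"
      by (simp add: algebra_simps)
    have \<delta>: "\<delta>' = x - of_nat n + y' + z' - \<epsilon>'" 
      using that(1) by (simp add: algebra_simps)
    have "\<delta>' - x + of_nat (n - J) =
        (y' + of_nat b') + (z' + of_nat c') - (\<epsilon>' + of_nat e') - of_nat p"
      using J(2) by (simp add: of_nat_diff J' \<delta>)
    also have "of_nat p dvd \<dots>"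
      by (rule dvd_diff[OF dvd_diff[OF dvd_add[OF that(2,3)] that(4)] dvd_refl])
    finally show ?thesis
      using J by (intro dvd_mult dvd_pochhammer[of _ _ "n - J"]) auto
  qed
  have "(of_nat p)\<^sup>2 dvd
      (- 1) ^ k * of_nat (n choose k) * pochhammer x k * pochhammer (1 - y) k *
      pochhammer (1 - z) k * pochhammer (1 + of_nat k) (n - k) *
      pochhammer (\<delta> - x) (n - k) * pochhammer (\<epsilon> - x) (n - k)" for k
  proof -
    have "of_nat p dvd pochhammer (1 - y) k * pochhammer (\<delta> - x) (n - k)"
      by (rule key[of \<delta> \<epsilon> y z b c e]) (use assms in auto)
    moreover have "of_nat p dvd pochhammer (1 - z) k * pochhammer (\<epsilon> - x) (n - k)"
      by (rule key[of \<epsilon> \<delta> z y c b d]) (use assms in \<open>auto simp: add_ac\<close>)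
    ultimately have "(of_nat p)\<^sup>2 dvd (pochhammer (1 - y) k * pochhammer (\<delta> - x) (n - k)) *
        (pochhammer (1 - z) k * pochhammer (\<epsilon> - x) (n - k))"
      unfolding power2_eq_square by (rule mult_dvd_mono)
    then have "(of_nat p)\<^sup>2 dvd (pochhammer (1 - y) k * pochhammer (\<delta> - x) (n - k)) *
        (pochhammer (1 - z) k * pochhammer (\<epsilon> - x) (n - k)) *
        ((- 1) ^ k * of_nat (n choose k) * pochhammer x k * pochhammer (1 + of_nat k) (n - k))"
      by (rule dvd_mult2)
    then show ?thesis by (simp only: mult_ac)
  qed
  then show ?thesis
    by (subst whipple_terminating) (auto simp: bal add.assoc intro!: dvd_sum)
qed

section \<open>Series with cleared denominators\<close>

text \<open>This is \<open>(-n)\<^sub>k / k! = (-1)^k (n choose k)\<close> multiplied by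
  \<open>m!\<close>. It brings the cleared series into the signed binomial form of Whipple's
  sum.\<close>

lemma pochhammer_minus_of_nat_mult:
  assumes "k \<le> n" "n \<le> m"
  shows "pochhammer (- of_nat n) k * pochhammer (1 + of_nat k) (m - k) =
         ((- 1) ^ k * of_nat (n choose k) * of_nat (fact m) :: 'a::comm_ring_1)"
proof -
  have "fact (n - k) * pochhammer (Suc (n - k)) k = (fact n :: nat)"
    using pochhammer_product'[of "1 :: nat" "n - k" k] assms by (simp add: pochhammer_fact)
  moreover have "fact k * pochhammer (Suc k) (m - k) = (fact m :: nat)"
    using pochhammer_product'[of "1 :: nat" k "m - k"] assms by (simp add: pochhammer_fact)
  moreover have "fact k * fact (n - k) * (n choose k) = fact n"
    using binomial_fact_lemma[of k n] assms by simp
  ultimately have "fact k * fact (n - k) * (pochhammer (Suc (n - k)) k * pochhammer (Suc k) (m - k)) =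
      fact k * fact (n - k) * ((n choose k) * fact m)"
    by (metis mult.assoc mult.left_commute)
  then have nat: "pochhammer (Suc (n - k)) k * pochhammer (Suc k) (m - k) = (n choose k) * fact m"
    by simp
  have "pochhammer (- of_nat n) k = (- 1) ^ k * (of_nat (pochhammer (Suc (n - k)) k) :: 'a)"
    using assms by (simp add: pochhammer_minus flip: pochhammer_of_nat) (simp add: of_nat_diff add_ac)
  moreover have "pochhammer (1 + of_nat k) (m - k) = (of_nat (pochhammer (Suc k) (m - k)) :: 'a)"
    by (simp flip: pochhammer_of_nat)
  ultimately have "pochhammer (- of_nat n) k * pochhammer (1 + of_nat k) (m - k) =
      (- 1) ^ k * (of_nat (pochhammer (Suc (n - k)) k * pochhammer (Suc k) (m - k)) :: 'a)"
    by (simp add: mult.assoc)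
  then show ?thesis unfolding nat by (simp add: mult.assoc)
qed

text \<open>
  The series truncated at \<open>m\<close>, multiplied by \<open>(1)\<^sub>m\<^sup>2 (\<delta>)\<^sub>m (\<epsilon>)\<^sub>m\<close> to clear its denominators.
\<close>

definition cleared_hypergeo :: "nat \<Rightarrow> 'a::comm_ring_1 \<Rightarrow> 'a \<Rightarrow> 'a \<Rightarrow> 'a \<Rightarrow> 'a \<Rightarrow> 'a \<Rightarrow> 'a" where
  "cleared_hypergeo m \<gamma> \<delta> \<epsilon> x y z =
     (\<Sum>k\<le>m. pochhammer x k * pochhammer y k * pochhammer z k * (pochhammer \<gamma> k *
        (pochhammer (1 + of_nat k) (m - k))\<^sup>2 *
        pochhammer (\<delta> + of_nat k) (m - k) * pochhammer (\<epsilon> + of_nat k) (m - k)))"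

lemma cleared_hypergeo_commute:
  "cleared_hypergeo m \<gamma> \<delta> \<epsilon> x y z = cleared_hypergeo m \<gamma> \<delta> \<epsilon> y x z"
  by (simp add: cleared_hypergeo_def mult_ac)

lemma cleared_hypergeo_affine:
  assumes "q dvd P" "q dvd Q"
  shows "q\<^sup>2 dvd cleared_hypergeo m \<gamma> \<delta> \<epsilon> (a + P) (b + Q) c
            - cleared_hypergeo m \<gamma> \<delta> \<epsilon> (a + P) b (c + Q)
            - cleared_hypergeo m \<gamma> \<delta> \<epsilon> a (b + Q) (c + P)
            + cleared_hypergeo m \<gamma> \<delta> \<epsilon> a b (c + (P + Q))"
  unfolding cleared_hypergeo_def sum_subtractf[symmetric] sum.distrib[symmetric]
    left_diff_distrib[symmetric] distrib_right[symmetric]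
  by (intro dvd_sum dvd_mult2 pochhammer_prod_affine assms)

lemma cleared_hypergeo_terminating_dvd:
  fixes x z \<gamma> \<delta> \<epsilon> :: "'a::idom"
  assumes "\<delta> + \<epsilon> = x - of_nat n + z + \<gamma>"
    and "of_nat p dvd z + of_nat b" "of_nat p dvd \<gamma> + of_nat c"
      "of_nat p dvd \<delta> + of_nat d" "of_nat p dvd \<epsilon> + of_nat e"
    and "b \<le> d" "c \<le> e" "d < p" "e < p" "p + max d e \<le> n + b + c" and "n \<le> m"
  shows "(of_nat p)\<^sup>2 dvd cleared_hypergeo m \<gamma> \<delta> \<epsilon> x (- of_nat n) z"
proof -
  \<comment> \<open>The terms beyond \<open>n\<close> vanish; \<open>C\<close> collects what the
    remaining ones have in common once the products up to \<open>m\<close> are cut at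
    \<open>n\<close>.\<close>
  define C where "C = of_nat (fact m) * pochhammer (1 + of_nat n) (m - n) *
      pochhammer (\<delta> + of_nat n) (m - n) * pochhammer (\<epsilon> + of_nat n) (m - n)"
  have split: "pochhammer (u + of_nat k) (m - k) =
      pochhammer (u + of_nat k) (n - k) * pochhammer (u + of_nat n) (m - n)"
    if "k \<le> n" for k and u :: 'a
    using pochhammer_product[of "n - k" "m - k" "u + of_nat k"] that \<open>n \<le> m\<close>
    by (simp add: of_nat_diff)
  have "cleared_hypergeo m \<gamma> \<delta> \<epsilon> x (- of_nat n) z =
      (\<Sum>k\<le>n. pochhammer x k * pochhammer (- of_nat n) k * pochhammer z k * (pochhammer \<gamma> k *
        (pochhammer (1 + of_nat k) (m - k))\<^sup>2 *
        pochhammer (\<delta> + of_nat k) (m - k) * pochhammer (\<epsilon> + of_nat k) (m - k)))"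
    unfolding cleared_hypergeo_def using \<open>n \<le> m\<close>
    by (intro sum.mono_neutral_right) (auto simp: pochhammer_of_nat_eq_0_lemma)
  also have "\<dots> = (\<Sum>k\<le>n. C * ((- 1) ^ k * of_nat (n choose k) * pochhammer x k *
            pochhammer z k * pochhammer \<gamma> k * pochhammer (1 + of_nat k) (n - k) *
            pochhammer (\<delta> + of_nat k) (n - k) * pochhammer (\<epsilon> + of_nat k) (n - k)))"
  proof (rule sum.cong)
    fix k assume "k \<in> {..n}"
    then have k: "k \<le> n" by simp
    have "pochhammer x k * pochhammer (- of_nat n) k * pochhammer z k * (pochhammer \<gamma> k *
        (pochhammer (1 + of_nat k) (m - k))\<^sup>2 *
        pochhammer (\<delta> + of_nat k) (m - k) * pochhammer (\<epsilon> + of_nat k) (m - k)) =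
      pochhammer x k * (pochhammer (- of_nat n) k * pochhammer (1 + of_nat k) (m - k)) *
        pochhammer z k * (pochhammer \<gamma> k * pochhammer (1 + of_nat k) (m - k) *
        pochhammer (\<delta> + of_nat k) (m - k) * pochhammer (\<epsilon> + of_nat k) (m - k))"
      by (simp add: power2_eq_square mult_ac)
    also have "\<dots> = C * ((- 1) ^ k * of_nat (n choose k) * pochhammer x k *
            pochhammer z k * pochhammer \<gamma> k * pochhammer (1 + of_nat k) (n - k) *
            pochhammer (\<delta> + of_nat k) (n - k) * pochhammer (\<epsilon> + of_nat k) (n - k))"
      unfolding pochhammer_minus_of_nat_mult[OF k \<open>n \<le> m\<close>]
      unfolding split[OF k]
      by (simp add: C_def mult_ac)
    finally show "pochhammer x k * pochhammer (- of_nat n) k * pochhammer z k * (pochhammer \<gamma> k *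
        (pochhammer (1 + of_nat k) (m - k))\<^sup>2 *
        pochhammer (\<delta> + of_nat k) (m - k) * pochhammer (\<epsilon> + of_nat k) (m - k)) = \<dots>" .
  qed simp
  also have "(of_nat p)\<^sup>2 dvd \<dots>"
    unfolding sum_distrib_left[symmetric]
    by (intro dvd_mult whipple_sum_dvd[where b = b and c = c and d = d and e = e] assms)
  finally show ?thesis .
qed

text \<open>The hypotheses treat \<open>(\<alpha>, a)\<close> and \<open>(\<rho>, n)\<close> alike
  because either parameter may terminate a series. Shifting \<open>\<beta>\<close> by multiples of
  \<open>p\<close> keeps its residue condition.\<close>

lemma cleared_hypergeo_dvd:
  fixes \<alpha> \<beta> \<gamma> \<delta> \<epsilon> \<rho> :: "'a::idom"
  assumes bal: "\<delta> + \<epsilon> = \<rho> + \<alpha> + \<beta> + \<gamma>"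
    and res: "of_nat p dvd \<alpha> + of_nat a" "of_nat p dvd \<rho> + of_nat n"
      "of_nat p dvd \<beta> + of_nat b" "of_nat p dvd \<gamma> + of_nat c"
      "of_nat p dvd \<delta> + of_nat d" "of_nat p dvd \<epsilon> + of_nat e"
    and le: "b \<le> d" "c \<le> e" "d < p" "e < p" "p + max d e \<le> a + b + c" "p + max d e \<le> n + b + c"
      "a \<le> m" "n \<le> m"
  shows "(of_nat p)\<^sup>2 dvd cleared_hypergeo m \<gamma> \<delta> \<epsilon> \<rho> \<alpha> \<beta>"
proof -
  define P Q where "P = \<rho> + of_nat n" and "Q = \<alpha> + of_nat a"
  let ?H = "cleared_hypergeo m \<gamma> \<delta> \<epsilon>"
  note terminating = cleared_hypergeo_terminating_dvd[where b = b and c = c and d = d and e = e]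
  have PQ: "of_nat p dvd P" "of_nat p dvd Q" using res by (simp_all add: P_def Q_def)
  have dvd: "of_nat p dvd \<beta> + h + of_nat b" if "of_nat p dvd h" for h
    using dvd_add[OF res(3) that] by (simp add: add_ac)
  have "(of_nat p)\<^sup>2 dvd ?H (- of_nat n + P) (- of_nat a) (\<beta> + Q)"
    using bal res le PQ by (intro terminating dvd) (auto simp: P_def Q_def)
  moreover have "(of_nat p)\<^sup>2 dvd ?H (- of_nat n) (- of_nat a + Q) (\<beta> + P)"
    using bal res le PQ
    \<comment> \<open>Only here does \<open>- n\<close> terminate the series, so it is moved to the
      second argument.\<close>
    by (subst cleared_hypergeo_commute, intro terminating dvd) (auto simp: P_def Q_def)
  moreover have "(of_nat p)\<^sup>2 dvd ?H (- of_nat n) (- of_nat a) (\<beta> + (P + Q))"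
    using bal res le PQ by (intro terminating dvd) (auto simp: P_def Q_def)
  ultimately have *: "(of_nat p)\<^sup>2 dvd ?H (- of_nat n + P) (- of_nat a) (\<beta> + Q)
      + ?H (- of_nat n) (- of_nat a + Q) (\<beta> + P) - ?H (- of_nat n) (- of_nat a) (\<beta> + (P + Q))"
    by (intro dvd_add dvd_diff)
  have "(of_nat p)\<^sup>2 dvd ?H (- of_nat n + P) (- of_nat a + Q) \<beta>"
    using dvd_add[OF cleared_hypergeo_affine[OF PQ, of m \<gamma> \<delta> \<epsilon> "- of_nat n" "- of_nat a" \<beta>] *]
    by simp
  then show ?thesis by (simp add: P_def Q_def)
qed

section \<open>Units and congruences in the \<open>p\<close>-adic numbers\<close>

text \<open>Inverses modulo each \<open>p^n\<close> can be chosen independently: they are unique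
  modulo \<open>p^n\<close>, hence automatically coherent.\<close>

lemma padic_int_dvd_1:
  fixes x :: "'p::prime_card padic_int"
  assumes "\<not> of_nat CARD('p) dvd x"
  shows "x dvd 1"
proof -
  let ?p = "int CARD('p)"
  note coh = padic_coherent_padic_res[of x]
  have "coprime (padic_res x n) (?p ^ n)" for n
  proof (cases n)
    case (Suc k)
    have "padic_res x 1 \<noteq> 0" using assms by (simp add: p_dvd_padic_int_iff)
    then have "\<not> ?p dvd padic_res x n"
      using padic_coherent_le[OF coh, of 1 n] Suc by (auto simp: dvd_eq_mod_eq_0)
    then have "coprime ?p (padic_res x n)"
      using prime_card_int[where 'a = 'p] by (rule prime_imp_coprime[rotated])
    then show ?thesis by (simp add: coprime_commute)
  qed auto
  then have "\<exists>y. [padic_res x n * y = 1] (mod ?p ^ n)" for n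
    by (rule cong_solve_coprime_int)
  then obtain y where y: "[padic_res x n * y n = 1] (mod ?p ^ n)" for n by metis
  have "padic_coherent CARD('p) (\<lambda>n. y n mod ?p ^ n)"
  proof (rule padic_coherentI)
    fix n
    have "[padic_res x (Suc n) * y (Suc n) = 1] (mod ?p ^ n)"
      using cong_dvd_modulus[OF y[of "Suc n"]] by (simp add: le_imp_power_dvd)
    moreover have "[padic_res x (Suc n) = padic_res x n] (mod ?p ^ n)"
      using padic_coherentD[OF coh] by (simp add: cong_def)
    ultimately have "[padic_res x n * y (Suc n) = 1] (mod ?p ^ n)"
      by (meson cong_scalar_right cong_sym cong_trans)
    then have "[y n * (padic_res x n * y (Suc n)) = y n * 1] (mod ?p ^ n)"
      by (rule cong_scalar_left)
    moreover have "[padic_res x n * y n * y (Suc n) = 1 * y (Suc n)] (mod ?p ^ n)"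
      using y by (rule cong_scalar_right)
    ultimately have "[y (Suc n) = y n] (mod ?p ^ n)"
      by (simp add: mult_ac) (meson cong_sym cong_trans)
    then show "y (Suc n) mod ?p ^ n = y n mod ?p ^ n" by (simp add: cong_def)
  qed
  then have "padic_res (Abs_padic_int (\<lambda>n. y n mod ?p ^ n) :: 'p padic_int) = (\<lambda>n. y n mod ?p ^ n)"
    by (simp add: Abs_padic_int_inverse)
  then have "x * Abs_padic_int (\<lambda>n. y n mod ?p ^ n) = 1"
    using y by (intro iffD1[OF padic_res_inject] ext)
      (simp add: times_padic_int.rep_eq one_padic_int.rep_eq mod_mult_right_eq cong_def)
  then show ?thesis by (metis dvd_triv_left)
qed

text \<open>Valuation at most one, in the form in which (iii) is used.\<close>

lemma padic_int_dvd_p: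
  fixes x :: "'p::prime_card padic_int"
  assumes "\<not> (of_nat CARD('p))\<^sup>2 dvd x"
  shows "x dvd of_nat CARD('p)"
proof (cases "of_nat CARD('p) dvd x")
  case True
  then obtain y where y: "x = of_nat CARD('p) * y" by (elim dvdE)
  then have "y dvd 1"
    using assms by (intro padic_int_dvd_1) (auto simp: power2_eq_square)
  then show ?thesis using mult_dvd_mono[of "of_nat CARD('p)" "of_nat CARD('p)" y 1] y by simp
next
  case False
  then have "x dvd 1" by (rule padic_int_dvd_1)
  then show ?thesis using one_dvd dvd_trans by blast
qed

lemma padic_residue_properties:
  fixes x :: "'p::prime_card padic_int"
  shows "padic_residue x < CARD('p)" "of_nat CARD('p) dvd x - of_nat (padic_residue x)"
  using theI'[OF padic_residue_ex1[of x]] unfolding padic_residue_def by auto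

lemma p_dvd_add_of_nat_iff:
  fixes x :: "'p::prime_card padic_int"
  assumes "j < CARD('p)"
  shows "of_nat CARD('p) dvd x + of_nat j \<longleftrightarrow> j = padic_residue (- x)"
proof -
  have "of_nat CARD('p) dvd x + of_nat j \<longleftrightarrow> of_nat CARD('p) dvd (- x) - of_nat j"
    using dvd_minus_iff[of "of_nat CARD('p)" "x + of_nat j"] by (simp add: algebra_simps)
  also have "\<dots> \<longleftrightarrow> j = padic_residue (- x)"
    using padic_residue_ex1[of "- x"] padic_residue_properties[of "- x"] assms by blast
  finally show ?thesis .
qed

text \<open>The first factor divisible by \<open>p\<close> has index
  \<open>padic_residue (- x)\<close>, so none of the first \<open>k\<close> is.\<close>

lemma pochhammer_dvd_1:
  fixes x :: "'p::prime_card padic_int"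
  assumes "k \<le> padic_residue (- x)"
  shows "pochhammer x k dvd 1"
proof -
  have "x + of_nat j dvd 1" if "j < k" for j
    using that assms padic_residue_properties(1)[of "- x"] p_dvd_add_of_nat_iff[of j x]
    by (intro padic_int_dvd_1) auto
  then show ?thesis
    unfolding pochhammer_prod using prod_dvd_prod[of "{0..<k}" "\<lambda>j. x + of_nat j" "\<lambda>_. 1"] by simp
qed

lemma fact_dvd_1:
  assumes "k < CARD('p::prime_card)"
  shows "(fact k :: 'p padic_int) dvd 1"
proof -
  have "padic_residue (- 1 :: 'p padic_int) = CARD('p) - 1"
    using p_dvd_add_of_nat_iff[of "CARD('p) - 1" "1 :: 'p padic_int"] CARD_prime_card_pos[where 'p = 'p]
    by (simp add: of_nat_diff)
  then show ?thesis
    using assms pochhammer_dvd_1[of k "1 :: 'p padic_int"] by (simp add: pochhammer_fact)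
qed

section \<open>Passage to the fraction field\<close>

lemma to_fract_of_nat [simp]: "to_fract (of_nat n) = of_nat n"
  by (induction n) auto

lemma to_fract_power [simp]: "to_fract (x ^ n) = to_fract x ^ n"
  by (induction n) auto

lemma to_fract_pochhammer: "to_fract (pochhammer x k) = pochhammer (to_fract x) k"
  by (induction k) (auto simp: pochhammer_Suc)

lemma to_fract_fact:
  "to_fract (fact k :: 'a::{idom, ring_char_0}) = fact k"
  by (simp add: pochhammer_fact to_fract_pochhammer)

lemma padic_cong_0_iff:
  "padic_cong m (to_fract x) 0 \<longleftrightarrow> (of_nat CARD('p)) ^ m dvd (x :: 'p::prime_card padic_int)"
proof -
  have "of_nat CARD('p) ^ m * to_fract z = to_fract (of_nat CARD('p) ^ m * z)" for z :: "'p padic_int"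
    by simp
  then show ?thesis unfolding padic_cong_def dvd_def diff_0_right by (simp only: to_fract_eq_iff)
qed

lemma padic_cong_0_add:
  assumes "padic_cong m x 0" "padic_cong m y 0"
  shows "padic_cong m (x + y) 0"
proof -
  obtain u v where "x = of_nat CARD('a) ^ m * to_fract u" "y = of_nat CARD('a) ^ m * to_fract v"
    using assms by (auto simp: padic_cong_def)
  then have "x + y - 0 = of_nat CARD('a) ^ m * to_fract (u + v)" by (simp add: distrib_left)
  then show ?thesis unfolding padic_cong_def by blast
qed

lemma padic_cong_0_sum:
  "(\<And>k. k \<in> A \<Longrightarrow> padic_cong m (f k) 0) \<Longrightarrow> padic_cong m (sum f A) 0"
proof (induction A rule: infinite_finite_induct)
  case (insert x F)
  then show ?case by (simp add: padic_cong_0_add)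
qed (auto simp: padic_cong_def intro!: exI[of _ 0])

text \<open>Valuation at least \<open>i + m\<close> over valuation at most \<open>i\<close>. The
  second assumption also excludes \<open>y = 0\<close>.\<close>

lemma padic_cong_0_divide:
  fixes x y :: "'p::prime_card padic_int"
  assumes "(of_nat CARD('p)) ^ (i + m) dvd x" "y dvd (of_nat CARD('p)) ^ i"
  shows "padic_cong m (to_fract x / to_fract y) 0"
proof -
  obtain u v where u: "x = of_nat CARD('p) ^ (i + m) * u" and v: "of_nat CARD('p) ^ i = y * v"
    using assms by (auto elim!: dvdE)
  have "of_nat CARD('p) ^ i \<noteq> (0 :: 'p padic_int)"
    using CARD_prime_card_pos[where 'p = 'p] by simp
  then have "y \<noteq> 0" using v by auto
  have "x = of_nat CARD('p) ^ m * (v * u) * y" unfolding u power_add v by (simp add: mult_ac)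
  then have "to_fract x / to_fract y = to_fract (of_nat CARD('p) ^ m * (v * u))"
    using \<open>y \<noteq> 0\<close> by simp
  then show ?thesis using padic_cong_0_iff by (metis dvd_triv_left)
qed

section \<open>The supercongruence\<close>

theorem theorem2p15:
  fixes p :: nat
    and \<alpha> \<beta> \<gamma> \<delta> \<epsilon> \<rho> :: "'p::prime_card padic_int"
  assumes p: "p = CARD('p)" "odd p"
    and unit: "\<alpha> dvd 1"
    and i: "padic_residue (- \<alpha>) \<le> min (padic_residue (- \<delta>)) (padic_residue (- \<epsilon>))"
           "padic_residue (- \<beta>) \<le> padic_residue (- \<delta>)"
           "padic_residue (- \<gamma>) \<le> padic_residue (- \<epsilon>)"
    and ii: "padic_residue (- \<alpha>) + padic_residue (- \<beta>) + padic_residue (- \<gamma>)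
               \<ge> p + max (padic_residue (- \<delta>)) (padic_residue (- \<epsilon>))"
    and iii: "\<not> padic_cong 2 (pochhammer (to_fract \<delta>) (p - 1)) 0"
             "\<not> padic_cong 2 (pochhammer (to_fract \<epsilon>) (p - 1)) 0"
    and rho: "\<rho> = \<delta> + \<epsilon> - \<alpha> - \<beta> - \<gamma>"
  shows "padic_cong 2
           (trunc_hypergeo [to_fract \<rho>, to_fract \<alpha>, to_fract \<beta>, to_fract \<gamma>]
                           [1, to_fract \<delta>, to_fract \<epsilon>] 1 (p - 1)) 0"
proof -
  define a b c d e where "a = padic_residue (- \<alpha>)" and "b = padic_residue (- \<beta>)"
    and "c = padic_residue (- \<gamma>)" and "d = padic_residue (- \<delta>)" and "e = padic_residue (- \<epsilon>)"
  define n where "n = p + d + e - a - b - c"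
  define m where "m = min d e"
  let ?p = "of_nat p :: 'p padic_int"
  have le: "a \<le> d" "a \<le> e" "b \<le> d" "c \<le> e" "p + d \<le> a + b + c" "p + e \<le> a + b + c"
    using i ii by (auto simp: a_def b_def c_def d_def e_def)
  have lt: "a < p" "b < p" "c < p" "d < p" "e < p"
    using padic_residue_properties(1) by (auto simp: a_def b_def c_def d_def e_def p)
  \<comment> \<open>The subtraction in \<open>n\<close> is exact as \<open>a \<le> d\<close>,
    \<open>c \<le> e\<close>, \<open>b < p\<close>; (ii) gives \<open>n \<le> m\<close>. Since
    \<open>n + b + c = p + d + e - a\<close>, the bound \<open>a \<le> m\<close> is (ii) with
    \<open>n\<close> in place of \<open>a\<close>.\<close>
  have n: "n + a + b + c = p + d + e" "n \<le> d" "n \<le> e" using le lt by (auto simp: n_def)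
  have res: "?p dvd x + of_nat (padic_residue (- x))" for x :: "'p padic_int"
    using p_dvd_add_of_nat_iff[of _ x] padic_residue_properties(1)[of "- x"] p by auto
  note res' = res[of \<alpha>, folded a_def] res[of \<beta>, folded b_def] res[of \<gamma>, folded c_def]
    res[of \<delta>, folded d_def] res[of \<epsilon>, folded e_def]
  have res_\<rho>: "?p dvd \<rho> + of_nat n"
  proof -
    have "of_nat n + of_nat a + of_nat b + of_nat c = (?p + of_nat d + of_nat e)"
      unfolding of_nat_add[symmetric] n(1) ..
    then have "of_nat n = ?p + of_nat d + of_nat e - of_nat a - of_nat b - of_nat c"
      by (simp add: algebra_simps)
    then have "\<rho> + of_nat n = ?p + (\<delta> + of_nat d) + (\<epsilon> + of_nat e) - (\<alpha> + of_nat a)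
        - (\<beta> + of_nat b) - (\<gamma> + of_nat c)" by (simp add: rho)
    also have "?p dvd \<dots>" by (intro dvd_add[of ?p] dvd_diff[of ?p] res' dvd_refl)
    finally show ?thesis .
  qed
  note divide = padic_cong_0_divide[where 'p = 'p, folded p(1)]
  define N where "N k = pochhammer \<rho> k * pochhammer \<alpha> k * pochhammer \<beta> k * pochhammer \<gamma> k" for k
  \<comment> \<open>One factorial is \<open>(1)\<^sub>k\<close>, the other the \<open>k!\<close> of
    the series.\<close>
  define D where "D k = fact k * pochhammer \<delta> k * pochhammer \<epsilon> k * fact k" for k
  define H where "H = cleared_hypergeo m \<gamma> \<delta> \<epsilon> \<rho> \<alpha> \<beta>"
  have "trunc_hypergeo [to_fract \<rho>, to_fract \<alpha>, to_fract \<beta>, to_fract \<gamma>]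
        [1, to_fract \<delta>, to_fract \<epsilon>] 1 (p - 1) = (\<Sum>k=0..p - 1. to_fract (N k) / to_fract (D k))"
    by (simp add: trunc_hypergeo_def N_def D_def to_fract_pochhammer to_fract_fact mult.assoc
        flip: pochhammer_fact)
  also have "{0..p - 1} = {..m} \<union> {m<..p - 1}" using lt by (auto simp: m_def)
  also have "(\<Sum>k\<in>\<dots>. to_fract (N k) / to_fract (D k)) =
      (\<Sum>k\<le>m. to_fract (N k) / to_fract (D k)) + (\<Sum>k\<in>{m<..p - 1}. to_fract (N k) / to_fract (D k))"
    by (intro sum.union_disjoint) auto
  also have "padic_cong 2 \<dots> 0"
  proof (rule padic_cong_0_add)
    have "pochhammer \<delta> m dvd 1" "pochhammer \<epsilon> m dvd 1"
      by (auto intro!: pochhammer_dvd_1 simp: m_def d_def e_def)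
    moreover have "(fact m :: 'p padic_int) dvd 1"
      using lt p by (intro fact_dvd_1) (auto simp: m_def)
    ultimately have D1: "D m dvd 1"
      by (simp add: D_def is_unit_mult_iff)
    have "to_fract (N k) / to_fract (D k) = to_fract (N k * ((pochhammer (1 + of_nat k) (m - k))\<^sup>2 *
        pochhammer (\<delta> + of_nat k) (m - k) * pochhammer (\<epsilon> + of_nat k) (m - k))) / to_fract (D m)"
      if "k \<le> m" for k
    proof -
      define T where "T = (pochhammer (1 + of_nat k) (m - k))\<^sup>2 *
        pochhammer (\<delta> + of_nat k) (m - k) * pochhammer (\<epsilon> + of_nat k) (m - k)"
      \<comment> \<open>All fractions with \<open>k \<le> m\<close> are extended to the common
        denominator \<open>D m\<close>, a unit.\<close>
      have "D m = D k * T"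
        unfolding D_def T_def pochhammer_fact pochhammer_product[OF that]
        by (simp add: power2_eq_square mult_ac)
      moreover from this have "T \<noteq> 0" using D1 by auto
      ultimately show ?thesis unfolding T_def[symmetric] by simp
    qed
    then have "(\<Sum>k\<le>m. to_fract (N k) / to_fract (D k)) = to_fract H / to_fract (D m)"
      by (simp add: H_def cleared_hypergeo_def N_def sum_divide_distrib mult_ac)
    moreover have "?p\<^sup>2 dvd H"
      unfolding H_def
    proof (rule cleared_hypergeo_dvd[OF _ res'(1) res_\<rho> res'(2-5)])
      show "\<delta> + \<epsilon> = \<rho> + \<alpha> + \<beta> + \<gamma>" by (simp add: rho)
    qed (use le lt n in \<open>auto simp: m_def\<close>)
    ultimately show "padic_cong 2 (\<Sum>k\<le>m. to_fract (N k) / to_fract (D k)) 0"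
      using divide[of 0 2 H "D m", unfolded add_0 power_0] D1 by simp
  next
    show "padic_cong 2 (\<Sum>k\<in>{m<..p - 1}. to_fract (N k) / to_fract (D k)) 0"
    proof (rule padic_cong_0_sum)
      fix k assume "k \<in> {m<..p - 1}"
      then have k: "m < k" "k < p" by auto
      have fact: "fact k dvd (1 :: 'p padic_int)" using k(2) unfolding p(1) by (rule fact_dvd_1)
      \<comment> \<open>As \<open>(x)\<^sub>k\<close> divides
        \<open>(x)\<^sub>p\<^sub>-\<^sub>1\<close>, (iii) allows at most one factor \<open>p\<close>
        in each of \<open>(\<delta>)\<^sub>k\<close> and
        \<open>(\<epsilon>)\<^sub>k\<close>.\<close>
      have poch_dvd_p: "pochhammer x k dvd ?p"
        if "\<not> padic_cong 2 (pochhammer (to_fract x) (p - 1)) 0" for x :: "'p padic_int"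
      proof -
        have "\<not> ?p\<^sup>2 dvd pochhammer x (p - 1)"
          using that unfolding to_fract_pochhammer[symmetric] padic_cong_0_iff p(1)[symmetric] .
        then have "pochhammer x (p - 1) dvd ?p" unfolding p(1) by (rule padic_int_dvd_p)
        moreover have "pochhammer x k dvd pochhammer x (p - 1)"
          using k pochhammer_product[of k "p - 1" x] by simp
        ultimately show ?thesis using dvd_trans by blast
      qed
      note D_dvd_p = poch_dvd_p[OF iii(1)] poch_dvd_p[OF iii(2)]
      \<comment> \<open>Both \<open>n\<close> and \<open>a\<close> are at most \<open>m < k\<close>;
        these two factors \<open>p\<close> remain after division.\<close>
      have num: "?p dvd pochhammer \<rho> k" "?p dvd pochhammer \<alpha> k"
        using k le n by (auto intro!: dvd_pochhammer[OF res_\<rho>] dvd_pochhammer[OF res'(1)] simp: m_def)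
      \<comment> \<open>each factor \<open>p\<close> in \<open>(\<delta>)\<^sub>k\<close> or \<open>(\<epsilon>)\<^sub>k\<close> is paid for by \<open>(\<beta>)\<^sub>k\<close> or \<open>(\<gamma>)\<^sub>k\<close> respectively\<close>
      have Ddvd: "D k dvd u * v" if "pochhammer \<delta> k dvd u" "pochhammer \<epsilon> k dvd v" for u v
        using mult_dvd_mono[OF mult_dvd_mono[OF mult_dvd_mono[OF fact that(1)] that(2)] fact]
        by (simp add: D_def)
      have Ndvd: "?p * ?p * u * v dvd N k" if "u dvd pochhammer \<beta> k" "v dvd pochhammer \<gamma> k" for u v
        unfolding N_def by (intro mult_dvd_mono num that)
      \<comment> \<open>At least four factors \<open>p\<close> stand against at most two in the
        first case, three against one in the others.\<close>
      consider "d < k" "e < k" | "d < k" "k \<le> e" | "k \<le> d" "e < k"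
        by (metis k(1) m_def min_less_iff_disj not_le)
      then show "padic_cong 2 (to_fract (N k) / to_fract (D k)) 0"
      proof cases
        case 1
        have "?p dvd pochhammer \<beta> k" "?p dvd pochhammer \<gamma> k"
          using 1 le by (auto intro!: dvd_pochhammer[OF res'(2)] dvd_pochhammer[OF res'(3)])
        from Ndvd[OF this] Ddvd[OF D_dvd_p] show ?thesis
          by (intro divide[of 2]) (simp_all add: power2_eq_square power4_eq_xxxx mult.assoc)
      next
        case 2
        have "?p dvd pochhammer \<beta> k"
          using 2 le by (auto intro!: dvd_pochhammer[OF res'(2)])
        moreover have "pochhammer \<epsilon> k dvd 1" using 2 by (simp add: pochhammer_dvd_1 e_def)
        ultimately show ?thesis using Ndvd[of ?p 1] Ddvd[OF D_dvd_p(1), of 1]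
          by (intro divide[of 1]) (simp_all add: power3_eq_cube mult.assoc)
      next
        case 3
        have "?p dvd pochhammer \<gamma> k"
          using 3 le by (auto intro!: dvd_pochhammer[OF res'(3)])
        moreover have "pochhammer \<delta> k dvd 1" using 3 by (simp add: pochhammer_dvd_1 d_def)
        ultimately show ?thesis using Ndvd[of 1 ?p] Ddvd[OF _ D_dvd_p(2), of 1]
          by (intro divide[of 1]) (simp_all add: power3_eq_cube mult.assoc)
      qed
    qed
  qed
  finally show ?thesis .
qed

end
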